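(* Let $m\ge 0$ be an integer and let $(f_{i,j},\varphi_{i,j})$ be a generic superfrieze of width $m$ with entries in a supercommutative ring $\mathcal{R}=\mathcal{R}_{\bar0}\oplus\mathcal{R}_{\bar1}$. Then it satisfies the following glide symmetry: $$f_{i,j}=f_{j-m-1,\,i-2},\qquad \varphi_{i,j}=\varphi_{j-m-\frac32,\,i-\frac32},\qquad \varphi_{i+\frac12,\,j+\frac12}=-\varphi_{j-m-1,\,i-1},$$ for all $i,j\in\mathbb{Z}$ for which the entries are part of the array (that is, $-2\le j-i\le m+1$ in the first identity and $-1\le j-i\le m+1$ in the other two).
   Context: Supercommutative ring: $\mathcal{R}=\mathcal{R}_{\bar0}\oplus\mathcal{R}_{\bar1}$ is $\mathbb{Z}/2$-graded; even elements are central, odd elements anticommute with each other and square to zero. Superfrieze of width $m$: an array consisting of even entries $f_{i,j}\in\mathcal{R}_{\bar0}$, for $i,j\in\mathbb{Z}$ with $-2\le j-i\le m+1$, and odd entries $\varphi_{i,j}\in\mathcal{R}_{\bar1}$, for $i,j$ both in $\mathbb{Z}$ or both in $\mathbb{Z}+\frac12$ with $-1\le j-i\le m+1$, such that: (Boundary) $f_{i,i-2}=0$, $f_{i,i-1}=1$, $f_{i,i+m}=1$, $f_{i,i+m+1}=0$ for all $i\in\mathbb{Z}$, and $\varphi_{i,i-1}=0=\varphi_{i,i+m+1}$ for all $i\in\frac12\mathbb{Z}$. (Frieze rule) for all $i,j\in\mathbb{Z}$ with $-1\le j-i\le m$, setting $A=f_{i,j}$, $B=f_{i+1,j}$, $C=f_{i,j+1}$,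 $D=f_{i+1,j+1}$, $\Xi=\varphi_{i+\frac12,j+\frac12}$, $\Psi=\varphi_{i+1,j+1}$, $\Phi=\varphi_{i,j+1}$, $\Sigma=\varphi_{i+\frac12,j+\frac32}$, one has $$AD-BC=1+\Sigma\Xi,\qquad A\Sigma-C\Xi=\Phi,\qquad B\Sigma-D\Xi=\Psi.$$ A superfrieze is generic if every even entry $f_{i,j}$ strictly inside the boundary rows (i.e. $0\le j-i\le m-1$) is invertible in $\mathcal{R}$. *)

theory Defs
  imports Complex_Main
begin

text \<open>
  The sort \<open>{ring, monoid_mult}\<close> is that of associative unital rings; unlike
  \<open>ring_1\<close> it does not exclude the zero ring.
\<close>

locale supercommutative_ring =
  fixes R0 R1 :: "'a::{ring, monoid_mult} set"
  assumes even_zero: "0 \<in> R0"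
    and even_diff: "\<lbrakk>a \<in> R0; b \<in> R0\<rbrakk> \<Longrightarrow> a - b \<in> R0"
    and odd_zero: "0 \<in> R1"
    and odd_diff: "\<lbrakk>a \<in> R1; b \<in> R1\<rbrakk> \<Longrightarrow> a - b \<in> R1"
    and decompose: "\<exists>a \<in> R0. \<exists>b \<in> R1. x = a + b"
    and independent: "R0 \<inter> R1 = {0}"
    and even_even: "\<lbrakk>a \<in> R0; b \<in> R0\<rbrakk> \<Longrightarrow> a * b \<in> R0"
    and even_odd: "\<lbrakk>a \<in> R0; b \<in> R1\<rbrakk> \<Longrightarrow> a * b \<in> R1"
    and odd_even: "\<lbrakk>a \<in> R1; b \<in> R0\<rbrakk> \<Longrightarrow> a * b \<in> R1"
    and odd_odd: "\<lbrakk>a \<in> R1; b \<in> R1\<rbrakk> \<Longrightarrow> a * b \<in> R0"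
    and even_central: "a \<in> R0 \<Longrightarrow> a * x = x * a"
    and odd_anticommute: "\<lbrakk>a \<in> R1; b \<in> R1\<rbrakk> \<Longrightarrow> a * b = - (b * a)"
    and odd_square: "a \<in> R1 \<Longrightarrow> a * a = 0"

definition two_sided_invertible :: "'a::monoid_mult \<Rightarrow> bool" where
  "two_sided_invertible x \<longleftrightarrow> (\<exists>y. x * y = 1 \<and> y * x = 1)"

definition frieze_rule ::
    "'a::{ring, monoid_mult} \<Rightarrow> 'a \<Rightarrow> 'a \<Rightarrow> 'a \<Rightarrow> 'a \<Rightarrow> 'a \<Rightarrow> 'a \<Rightarrow> 'a \<Rightarrow> bool" where
  "frieze_rule A B C D \<Xi> \<Psi> \<Phi> \<Sigma> \<longleftrightarrow>
     A * D - B * C = 1 + \<Sigma> * \<Xi> \<and> A * \<Sigma> - C * \<Xi> = \<Phi> \<and> B * \<Sigma> - D * \<Xi> = \<Psi>"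

definition odd_index :: "nat \<Rightarrow> rat \<Rightarrow> rat \<Rightarrow> bool" where
  "odd_index m i j \<longleftrightarrow>
     (i \<in> \<int> \<and> j \<in> \<int> \<or> i - 1/2 \<in> \<int> \<and> j - 1/2 \<in> \<int>) \<and>
     -1 \<le> j - i \<and> j - i \<le> of_nat m + 1"

text \<open>
  The arrays are represented by total functions; their values outside the index
  range of the frieze are unconstrained. Odd entries carry rational indices so that
  integral and half-integral positions can be written as they are.
\<close>

locale superfrieze = supercommutative_ring R0 R1
  for R0 R1 :: "'a::{ring, monoid_mult} set" +
  fixes m :: nat
    and f :: "int \<Rightarrow> int \<Rightarrow> 'a"
    and \<phi> :: "rat \<Rightarrow> rat \<Rightarrow> 'a"
  assumes f_even: "\<lbrakk>-2 \<le> j - i; j - i \<le> int m + 1\<rbrakk> \<Longrightarrow> f i j \<in> R0"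
    and \<phi>_odd: "odd_index m r s \<Longrightarrow> \<phi> r s \<in> R1"
    and f_boundary:
      "f i (i - 2) = 0" "f i (i - 1) = 1" "f i (i + int m) = 1" "f i (i + int m + 1) = 0"
    and \<phi>_boundary:
      "2 * r \<in> \<int> \<Longrightarrow> \<phi> r (r - 1) = 0"
      "2 * r \<in> \<int> \<Longrightarrow> \<phi> r (r + of_nat m + 1) = 0"
    and rule:
      "\<lbrakk>-1 \<le> j - i; j - i \<le> int m\<rbrakk> \<Longrightarrow>
       frieze_rule (f i j) (f (i + 1) j) (f i (j + 1)) (f (i + 1) (j + 1))
         (\<phi> (of_int i + 1/2) (of_int j + 1/2)) (\<phi> (of_int i + 1) (of_int j + 1))
         (\<phi> (of_int i) (of_int j + 1)) (\<phi> (of_int i + 1/2) (of_int j + 3/2))"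

locale generic_superfrieze = superfrieze +
  assumes generic: "\<lbrakk>0 \<le> j - i; j - i \<le> int m - 1\<rbrakk> \<Longrightarrow> two_sided_invertible (f i j)"

end

theory Submission
  imports Defs
begin

text \<open>
  Write \<open>p i j\<close> for the odd entry at the integral position \<open>(i, j)\<close> and \<open>e i j\<close> for the
  one at \<open>(i + 1/2, j + 1/2)\<close>. As for classical friezes, the symmetry holds because a
  row of the array and the column that should be its mirror image solve the same linear
  recurrence with the same initial values.

  Two neighbouring diamonds show that in the expressions \<open>p i (j + 1) - p i j\<close> and
  \<open>f i (j + 1) + f i (j - 1) + b * p i (j + 1)\<close> (with suitable \<open>b\<close>) the values for \<open>i\<close>
  and for \<open>i + 1\<close> are in the same ratio as \<open>f i j\<close> and \<open>f (i + 1) j\<close>. Since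
  those entries are invertible, both expressions are multiples of \<open>f i j\<close>, with factors
  that depend on \<open>j\<close> alone. This is the discrete Sturm--Liouville equation of the superfrieze,
  \<open>row_recurrence\<close>. Its coefficients can be read off wherever \<open>f i j = 1\<close>, in particular at
  \<open>i = j - m\<close>, next to the lower boundary.

  The frieze rule is self-dual: the diamond can be read from its opposite corner, with the
  integral and half-integral odd entries interchanged, at the price of one sign
  (\<open>signed_rule_dual\<close>). Carrying that sign as a parameter \<open>\<epsilon>\<close> makes the same argument prove
  a recurrence in \<open>i\<close> for fixed \<open>j\<close> on \<open>f\<close> and \<open>e\<close>, \<open>column_recurrence\<close>. Its coefficients,
  again taken next to the lower boundary, are, up to sign, the entries that give the
  coefficients of the row recurrence (\<open>bottom_odd\<close>). With equal values on the boundary,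
  induction along the row yields the symmetry for \<open>f\<close> and for \<open>p\<close>. The entries \<open>e\<close> are
  then expressed through \<open>f\<close> and \<open>p\<close> by the dual rule, and the remaining identity is
  the image of the frieze rule itself.
\<close>

section \<open>The frieze rule and its dual\<close>

text \<open>
  At \<open>\<epsilon> = 1\<close> this is the frieze rule. Reading a frieze diamond from the opposite corner
  gives \<open>\<epsilon> = -1\<close>.
\<close>
definition signed_rule ::
    "'a::{ring, monoid_mult} \<Rightarrow> 'a \<Rightarrow> 'a \<Rightarrow> 'a \<Rightarrow> 'a \<Rightarrow> 'a \<Rightarrow> 'a \<Rightarrow> 'a \<Rightarrow> 'a \<Rightarrow> bool" where
  "signed_rule \<epsilon> A B C D \<Xi> \<Psi> \<Phi> \<Sigma> \<longleftrightarrow>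
     A * D - B * C = 1 + \<epsilon> * (\<Sigma> * \<Xi>) \<and> \<Phi> = A * \<Sigma> - C * \<Xi> \<and> \<Psi> = B * \<Sigma> - D * \<Xi>"

context supercommutative_ring
begin

lemma even_minus: "a \<in> R0 \<Longrightarrow> - a \<in> R0"
  using even_diff[OF even_zero] by fastforce

lemma even_left_commute: "a \<in> R0 \<Longrightarrow> x * (a * y) = a * (x * y)"
  by (metis even_central mult.assoc)

lemma odd_left_square: "a \<in> R1 \<Longrightarrow> a * (a * x) = 0"
  by (metis odd_square mult.assoc mult_zero_left)

lemma odd_left_anticommute: "a \<in> R1 \<Longrightarrow> b \<in> R1 \<Longrightarrow> a * (b * x) = - (b * (a * x))"
  by (metis odd_anticommute mult.assoc minus_mult_left)

lemma invertible_left_cancel: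
  assumes "two_sided_invertible x" "x * u = x * (v::'a)"
  shows "u = v"
  using assms unfolding two_sided_invertible_def by (metis mult.assoc mult_1)

text \<open>
  The two odd equations form a linear system for \<open>\<Sigma>\<close> and \<open>\<Xi>\<close> with determinant
  \<open>A * D - B * C = 1 + \<epsilon> * (\<Sigma> * \<Xi>)\<close>. The nilpotent part of the determinant kills both
  unknowns, so Cramer's rule inverts the system without any division. The sign changes
  because \<open>\<Phi> * \<Psi> = - (\<Sigma> * \<Xi>)\<close>.
\<close>
lemma signed_rule_dual:
  assumes rule: "signed_rule \<epsilon> A B C D \<Xi> \<Psi> \<Phi> \<Sigma>"
    and even: "\<epsilon> \<in> R0" "A \<in> R0" "B \<in> R0" "C \<in> R0" "D \<in> R0"
    and odd: "\<Xi> \<in> R1" "\<Sigma> \<in> R1"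
  shows "signed_rule (- \<epsilon>) D B C A \<Psi> \<Xi> \<Sigma> \<Phi>"
proof -
  have det: "A * D - B * C = 1 + \<epsilon> * (\<Sigma> * \<Xi>)"
    and \<Phi>: "\<Phi> = A * \<Sigma> - C * \<Xi>" and \<Psi>: "\<Psi> = B * \<Sigma> - D * \<Xi>"
    using rule by (auto simp: signed_rule_def)
  have sq: "\<Xi> * \<Xi> = 0" "\<Sigma> * \<Sigma> = 0" "\<And>x. \<Sigma> * (\<Sigma> * x) = 0" "\<And>x. \<Xi> * (\<Xi> * x) = 0"
    and anti: "\<Xi> * \<Sigma> = - (\<Sigma> * \<Xi>)" "\<And>x. \<Xi> * (\<Sigma> * x) = - (\<Sigma> * (\<Xi> * x))"
    using odd odd_square odd_left_square odd_anticommute odd_left_anticommute by blast+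
  have "D * \<Phi> - C * \<Psi> = (A * D - B * C) * \<Sigma>"
    unfolding \<Phi> \<Psi> using even
    by (simp add: algebra_simps even_central even_left_commute)
  also have "\<dots> = \<Sigma>"
    unfolding det by (simp add: algebra_simps sq anti)
  finally have 1: "D * \<Phi> - C * \<Psi> = \<Sigma>" .
  have "B * \<Phi> - A * \<Psi> = (A * D - B * C) * \<Xi>"
    unfolding \<Phi> \<Psi> using even
    by (simp add: algebra_simps even_central even_left_commute)
  also have "\<dots> = \<Xi>"
    unfolding det by (simp add: algebra_simps sq anti)
  finally have 2: "B * \<Phi> - A * \<Psi> = \<Xi>" .
  have "\<Phi> * \<Psi> = - ((A * D - B * C) * (\<Sigma> * \<Xi>))"
    unfolding \<Phi> \<Psi> using even
    by (simp add: algebra_simps even_central even_left_commute sq anti)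
  also have "\<dots> = - (\<Sigma> * \<Xi>)"
    unfolding det by (simp add: algebra_simps sq anti)
  finally have "A * D - B * C = 1 + - \<epsilon> * (\<Phi> * \<Psi>)"
    using det by simp
  then show ?thesis
    using 1 2 even by (simp add: signed_rule_def even_central)
qed

section \<open>Recurrences along a strip of diamonds\<close>

text \<open>
  In the next two lemmas \<open>x0, x1, x2\<close> and \<open>y0, y1, y2\<close> are three consecutive even entries
  of two neighbouring rows, and the two diamonds share the edge \<open>x1, y1\<close> and the odd
  entry \<open>e1\<close>. The dual rule computes \<open>e1\<close> from either diamond; comparing the two results
  gives the identity.
\<close>
lemma adjacent_rules_odd:
  assumes rules: "signed_rule \<epsilon> x0 y0 x1 y1 e0 q1 p1 e1" "signed_rule \<epsilon> x1 y1 x2 y2 e1 q2 p2 e2"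
    and even: "\<epsilon> \<in> R0" "x0 \<in> R0" "x1 \<in> R0" "x2 \<in> R0" "y0 \<in> R0" "y1 \<in> R0" "y2 \<in> R0"
    and odd: "e0 \<in> R1" "e1 \<in> R1" "e2 \<in> R1"
  shows "x1 * (q2 - q1) = y1 * (p2 - p1)"
proof -
  have "e1 = x1 * - q1 - y1 * - p1"
    using signed_rule_dual[OF rules(1)] even odd by (simp add: signed_rule_def)
  moreover have "e1 = y1 * p2 - x1 * q2"
    using signed_rule_dual[OF rules(2)] even odd by (simp add: signed_rule_def)
  ultimately show ?thesis
    by (simp add: algebra_simps)
qed

text \<open>
  The difference of the two determinant equations is \<open>\<epsilon> * ((e2 + e0) * e1)\<close>. Modulo
  multiples of \<open>e1\<close>, which disappear in the product with \<open>e1\<close>, the odd equations identify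
  \<open>x1 * (e2 + e0)\<close> with \<open>p2 - p1 = b * x1\<close>. So the product is \<open>b * e1\<close>, and the dual rule
  expands \<open>e1\<close> into the correction terms on the two sides.
\<close>
lemma adjacent_rules_even:
  assumes rules: "signed_rule \<epsilon> x0 y0 x1 y1 e0 q1 p1 e1" "signed_rule \<epsilon> x1 y1 x2 y2 e1 q2 p2 e2"
    and even: "\<epsilon> \<in> R0" "x0 \<in> R0" "x1 \<in> R0" "x2 \<in> R0" "y0 \<in> R0" "y1 \<in> R0" "y2 \<in> R0"
    and odd: "e0 \<in> R1" "e1 \<in> R1" "e2 \<in> R1"
    and jump: "p2 - p1 = b * x1"
    and inv: "two_sided_invertible x1"
  shows "x1 * (y2 + y0 + \<epsilon> * (b * q2)) = y1 * (x2 + x0 + \<epsilon> * (b * p2))"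
proof -
  have e1: "e1 = y1 * p2 - x1 * q2"
    using signed_rule_dual[OF rules(2)] even odd by (simp add: signed_rule_def)
  have "p1 = x0 * e1 - x1 * e0" "p2 = x1 * e2 - x2 * e1"
    using rules by (simp_all add: signed_rule_def)
  then have "b * x1 = (x1 * e2 - x2 * e1) - (x0 * e1 - x1 * e0)"
    using jump by simp
  also have "\<dots> = x1 * (e2 + e0) - (x2 + x0) * e1"
    by (simp add: algebra_simps)
  finally have "x1 * (e2 + e0) * e1 = (b * x1 + (x2 + x0) * e1) * e1"
    by simp
  then have "x1 * ((e2 + e0) * e1) = b * (x1 * e1)"
    using odd_square[OF odd(2)] by (simp add: distrib_right mult.assoc)
  also have "\<dots> = x1 * (b * e1)"
    using even by (simp add: even_left_commute[of x1 b])
  finally have "x1 * ((e2 + e0) * e1) = x1 * (b * e1)" .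
  then have "(e2 + e0) * e1 = b * e1"
    by (rule invertible_left_cancel[OF inv])
  then have b: "e2 * e1 - e1 * e0 = b * e1"
    using odd_anticommute[of e1 e0] odd by (simp add: algebra_simps)
  have "x1 * (y2 + y0) - y1 * (x2 + x0) = \<epsilon> * (e2 * e1 - e1 * e0)"
    using rules even by (simp add: signed_rule_def algebra_simps even_central)
  also have "\<dots> = \<epsilon> * (b * (y1 * p2 - x1 * q2))"
    using b e1 by simp
  also have "\<dots> = y1 * (\<epsilon> * (b * p2)) - x1 * (\<epsilon> * (b * q2))"
    using even by (metis even_left_commute right_diff_distrib)
  finally show ?thesis
    by (simp add: algebra_simps)
qed

text \<open>
  Each step says that the ratio of \<open>u\<close> to \<open>x\<close> is the same at \<open>n\<close> and \<open>Suc n\<close>.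
\<close>
lemma proportional_from_start:
  fixes x u :: "nat \<Rightarrow> 'a"
  assumes step: "\<And>n. n < N \<Longrightarrow> x n * u (Suc n) = x (Suc n) * u n"
    and even: "\<And>n. n \<le> N \<Longrightarrow> x n \<in> R0"
    and inv: "\<And>n. n \<le> N \<Longrightarrow> two_sided_invertible (x n)"
    and start: "x 0 = 1"
    and "n \<le> N"
  shows "u n = u 0 * x n"
  using \<open>n \<le> N\<close>
proof (induction n)
  case 0
  show ?case by (simp add: start)
next
  case (Suc n)
  have "x n * u (Suc n) = x (Suc n) * (u 0 * x n)"
    using step Suc by simp
  also have "\<dots> = x n * (u 0 * x (Suc n))"
    using even[of n] even[of "Suc n"] Suc.prems
    by (metis Suc_leD even_central mult.assoc)
  finally show ?case
    by (rule invertible_left_cancel[OF inv, rotated]) (use Suc.prems in simp)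
qed

text \<open>
  \<open>L\<close>, \<open>M\<close>, \<open>R\<close> are three neighbouring lines of even entries, all read from the same end
  of the strip, with the odd entries \<open>s\<close> between \<open>L\<close> and \<open>M\<close> and \<open>t\<close> between
  \<open>M\<close> and \<open>R\<close>. The identities for adjacent diamonds say that \<open>t - s\<close> and
  \<open>R + L + \<epsilon> * (b * t)\<close> stay proportional to \<open>M\<close>. Starting where \<open>M = 1\<close>, the factors are
  the values at the start. The statement is abstract in the lines, and in \<open>\<epsilon>\<close>, so that it
  covers both directions of the array.
\<close>
lemma strip_recurrence:
  fixes L M R s t d0 d1 d2 :: "nat \<Rightarrow> 'a"
  assumes even: "\<epsilon> \<in> R0"
      "\<And>n. n \<le> N \<Longrightarrow> L n \<in> R0" "\<And>n. n \<le> N \<Longrightarrow> M n \<in> R0" "\<And>n. n \<le> N \<Longrightarrow> R n \<in> R0"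
    and odd: "\<And>n. n < N \<Longrightarrow> d0 n \<in> R1" "\<And>n. n < N \<Longrightarrow> d1 n \<in> R1" "\<And>n. n < N \<Longrightarrow> d2 n \<in> R1"
    and inv: "\<And>n. n \<le> N \<Longrightarrow> two_sided_invertible (M n)" and start: "M 0 = 1"
    and rule_LM: "\<And>n. n < N \<Longrightarrow> signed_rule \<epsilon> (L n) (L (Suc n)) (M n) (M (Suc n))
        (d0 n) (s (Suc n)) (s n) (d1 n)"
    and rule_MR: "\<And>n. n < N \<Longrightarrow> signed_rule \<epsilon> (M n) (M (Suc n)) (R n) (R (Suc n))
        (d1 n) (t (Suc n)) (t n) (d2 n)"
    and n: "n \<le> N"
  shows "t n - s n = (t 0 - s 0) * M n"
    and "R n + L n + \<epsilon> * ((t 0 - s 0) * t n) = (R 0 + L 0 + \<epsilon> * ((t 0 - s 0) * t 0)) * M n"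
proof -
  have jump: "t n - s n = (t 0 - s 0) * M n" if "n \<le> N" for n
  proof (rule proportional_from_start[where u = "\<lambda>n. t n - s n" and x = M, OF _ even(3) inv start that])
    show "M n * (t (Suc n) - s (Suc n)) = M (Suc n) * (t n - s n)" if "n < N" for n
      using that even odd by (intro adjacent_rules_odd[OF rule_LM rule_MR]) auto
  qed
  show "t n - s n = (t 0 - s 0) * M n"
    by (rule jump[OF n])
  show "R n + L n + \<epsilon> * ((t 0 - s 0) * t n) = (R 0 + L 0 + \<epsilon> * ((t 0 - s 0) * t 0)) * M n"
  proof (rule proportional_from_start[where u = "\<lambda>n. R n + L n + \<epsilon> * ((t 0 - s 0) * t n)"
        and x = M, OF _ even(3) inv start n])
    show "M n * (R (Suc n) + L (Suc n) + \<epsilon> * ((t 0 - s 0) * t (Suc n)))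
        = M (Suc n) * (R n + L n + \<epsilon> * ((t 0 - s 0) * t n))" if "n < N" for n
      by (rule adjacent_rules_even[OF rule_LM rule_MR _ _ _ _ _ _ _ _ _ _ jump])
        (use that even odd inv in auto)
  qed
qed

end

section \<open>Row and column recurrences of a superfrieze\<close>

context generic_superfrieze
begin

definition p :: "int \<Rightarrow> int \<Rightarrow> 'a" where
  "p i j = \<phi> (of_int i) (of_int j)"

definition e :: "int \<Rightarrow> int \<Rightarrow> 'a" where
  "e i j = \<phi> (of_int i + 1/2) (of_int j + 1/2)"

lemma p_odd: "-1 \<le> j - i \<Longrightarrow> j - i \<le> int m + 1 \<Longrightarrow> p i j \<in> R1"
  unfolding p_def
proof (rule \<phi>_odd)
  assume "-1 \<le> j - i" "j - i \<le> int m + 1"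
  then have "(of_int (-1) :: rat) \<le> of_int (j - i)" "(of_int (j - i) :: rat) \<le> of_int (int m + 1)"
    by (simp_all only: of_int_le_iff)
  then show "odd_index m (of_int i) (of_int j)"
    by (simp add: odd_index_def)
qed

lemma e_odd: "-1 \<le> j - i \<Longrightarrow> j - i \<le> int m + 1 \<Longrightarrow> e i j \<in> R1"
  unfolding e_def
proof (rule \<phi>_odd)
  assume "-1 \<le> j - i" "j - i \<le> int m + 1"
  then have "(of_int (-1) :: rat) \<le> of_int (j - i)" "(of_int (j - i) :: rat) \<le> of_int (int m + 1)"
    by (simp_all only: of_int_le_iff)
  then show "odd_index m (of_int i + 1/2) (of_int j + 1/2)"
    by (simp add: odd_index_def)
qed

lemma p_boundary: "p i (i - 1) = 0" "p i (i + int m + 1) = 0"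
proof -
  have "2 * (of_int i :: rat) \<in> \<int>" by simp
  from \<phi>_boundary[OF this] show "p i (i - 1) = 0" "p i (i + int m + 1) = 0"
    by (simp_all add: p_def)
qed

lemma e_boundary: "e i (i - 1) = 0" "e i (i + int m + 1) = 0"
proof -
  have "2 * (of_int i + 1/2 :: rat) = of_int (2 * i + 1)" by (simp add: algebra_simps)
  then have "2 * (of_int i + 1/2 :: rat) \<in> \<int>" by (metis Ints_of_int)
  from \<phi>_boundary[OF this] show "e i (i - 1) = 0" "e i (i + int m + 1) = 0"
    by (simp_all add: e_def algebra_simps)
qed

lemma one_even: "1 \<in> R0"
  using f_even[of "i - 1" i for i] f_boundary(2) by simp

lemma diamond:
  assumes "-1 \<le> j - i" "j - i \<le> int m"
  shows "signed_rule 1 (f i j) (f (i + 1) j) (f i (j + 1)) (f (i + 1) (j + 1))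
      (e i j) (p (i + 1) (j + 1)) (p i (j + 1)) (e i (j + 1))"
proof -
  have "of_int j + 3/2 = (of_int (j + 1) + 1/2 :: rat)" by simp
  from rule[OF assms, unfolded this] show ?thesis
    by (simp add: frieze_rule_def signed_rule_def p_def e_def)
qed

lemma diamond_dual:
  assumes "-1 \<le> j - i" "j - i \<le> int m"
  shows "signed_rule (- 1) (f (i + 1) (j + 1)) (f (i + 1) j) (f i (j + 1)) (f i j)
      (p (i + 1) (j + 1)) (e i j) (e i (j + 1)) (p i (j + 1))"
  using assms
  by (intro signed_rule_dual[OF diamond] one_even f_even e_odd) auto

lemma f_invertible:
  assumes "-1 \<le> j - i" "j - i \<le> int m"
  shows "two_sided_invertible (f i j)"
proof -
  consider "j = i - 1" | "j = i + int m" | "0 \<le> j - i" "j - i \<le> int m - 1"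
    using assms by linarith
  then show ?thesis
    by cases (auto simp: f_boundary generic two_sided_invertible_def[of 1])
qed

text \<open>
  The strip is traversed with \<open>i\<close> increasing from \<open>j - m\<close>, where the middle line has the
  entry \<open>1\<close>. Both \<open>f (j - m) (j + 1)\<close> and \<open>p (j - m) (j + 1)\<close> lie on the boundary and
  vanish, so only one entry remains in each coefficient.
\<close>
lemma row_recurrence:
  assumes "-1 \<le> j - i" "j - i \<le> int m"
  defines "b \<equiv> - p (j - int m) j"
  shows "p i (j + 1) - p i j = b * f i j"
    and "f i (j + 1) + f i (j - 1) + b * p i (j + 1) = f (j - int m) (j - 1) * f i j"
proof -
  define k where "k = (\<lambda>n::nat. j - int m + int n)"
  define n where "n = nat (i - j + int m)"
  have kn: "k n = i" and n: "n \<le> Suc m" using assms(1,2) by (auto simp: k_def n_def)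
  have k_Suc: "k (Suc n) = k n + 1" for n by (simp add: k_def)
  have 0: "k 0 = j - int m" "f (j - int m) (j + 1) = 0" "p (j - int m) (j + 1) = 0"
    "f (j - int m) j = 1"
    using f_boundary(3,4)[of "j - int m"] p_boundary(2)[of "j - int m"]
    by (simp_all add: k_def)
  have 1: "signed_rule 1 (f (k n) (j - 1)) (f (k (Suc n)) (j - 1)) (f (k n) j) (f (k (Suc n)) j)
        (e (k n) (j - 1)) (p (k (Suc n)) j) (p (k n) j) (e (k n) j)"
   and 2: "signed_rule 1 (f (k n) j) (f (k (Suc n)) j) (f (k n) (j + 1)) (f (k (Suc n)) (j + 1))
        (e (k n) j) (p (k (Suc n)) (j + 1)) (p (k n) (j + 1)) (e (k n) (j + 1))"
     if "n < Suc m" for n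
    using that diamond[of "j - 1" "k n"] diamond[of j "k n"] by (simp_all add: k_Suc, simp_all add: k_def)
  note rec = strip_recurrence[where N = "Suc m" and n = n
      and L = "\<lambda>n. f (k n) (j - 1)" and M = "\<lambda>n. f (k n) j" and R = "\<lambda>n. f (k n) (j + 1)"
      and s = "\<lambda>n. p (k n) j" and t = "\<lambda>n. p (k n) (j + 1)"
      and ?d0.0 = "\<lambda>n. e (k n) (j - 1)" and ?d1.0 = "\<lambda>n. e (k n) j"
      and ?d2.0 = "\<lambda>n. e (k n) (j + 1)",
      OF one_even _ _ _ _ _ _ _ _ 1 2 n]
  show "p i (j + 1) - p i j = b * f i j"
    using rec(1) f_even e_odd f_invertible unfolding kn 0 b_def by (simp add: k_def)
  show "f i (j + 1) + f i (j - 1) + b * p i (j + 1) = f (j - int m) (j - 1) * f i j"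
    using rec(2) f_even e_odd f_invertible unfolding kn 0 b_def by (simp add: k_def)
qed

text \<open>
  The dual diamonds fit together in columns. The strip is now traversed with \<open>j\<close> decreasing
  from \<open>i + m\<close>, so that again it starts at an entry \<open>1\<close> next to the lower boundary.
\<close>
lemma column_recurrence:
  assumes "-1 \<le> j - i" "j - i \<le> int m"
  defines "b \<equiv> - e i (i + int m)"
  shows "e (i - 1) j - e i j = b * f i j"
    and "f (i - 1) j + f (i + 1) j - b * e (i - 1) j = f (i + 1) (i + int m) * f i j"
proof -
  define k where "k = (\<lambda>n::nat. i + int m - int n)"
  define n where "n = nat (i + int m - j)"
  have kn: "k n = j" and n: "n \<le> Suc m" using assms(1,2) by (auto simp: k_def n_def)
  have k_Suc: "k n = k (Suc n) + 1" for n by (simp add: k_def)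
  have 0: "k 0 = i + int m" "f (i - 1) (i + int m) = 0" "e (i - 1) (i + int m) = 0"
    "f i (i + int m) = 1"
    using f_boundary(3)[of i] f_boundary(4)[of "i - 1"] e_boundary(2)[of "i - 1"]
    by (simp_all add: k_def)
  have 1: "signed_rule (- 1) (f (i + 1) (k n)) (f (i + 1) (k (Suc n))) (f i (k n)) (f i (k (Suc n)))
        (p (i + 1) (k n)) (e i (k (Suc n))) (e i (k n)) (p i (k n))"
   and 2: "signed_rule (- 1) (f i (k n)) (f i (k (Suc n))) (f (i - 1) (k n)) (f (i - 1) (k (Suc n)))
        (p i (k n)) (e (i - 1) (k (Suc n))) (e (i - 1) (k n)) (p (i - 1) (k n))"
     if "n < Suc m" for n
    using that diamond_dual[of "k (Suc n)" i] diamond_dual[of "k (Suc n)" "i - 1"]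
    by (simp_all add: k_Suc[of n], simp_all add: k_def)
  note rec = strip_recurrence[where N = "Suc m" and n = n
      and L = "\<lambda>n. f (i + 1) (k n)" and M = "\<lambda>n. f i (k n)" and R = "\<lambda>n. f (i - 1) (k n)"
      and s = "\<lambda>n. e i (k n)" and t = "\<lambda>n. e (i - 1) (k n)"
      and ?d0.0 = "\<lambda>n. p (i + 1) (k n)" and ?d1.0 = "\<lambda>n. p i (k n)"
      and ?d2.0 = "\<lambda>n. p (i - 1) (k n)",
      OF even_minus[OF one_even] _ _ _ _ _ _ _ _ 1 2 n]
  show "e (i - 1) j - e i j = b * f i j"
    using rec(1) f_even p_odd f_invertible unfolding kn 0 b_def by (simp add: k_def)
  show "f (i - 1) j + f (i + 1) j - b * e (i - 1) j = f (i + 1) (i + int m) * f i j"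
    using rec(2) f_even p_odd f_invertible unfolding kn 0 b_def by (simp add: k_def)
qed

section \<open>Glide symmetry\<close>

text \<open>
  In the last row of diamonds the boundary values reduce the frieze rule to
  \<open>\<Psi> = - \<Xi>\<close>. This identifies the odd coefficient of the row recurrence at \<open>j\<close>, up to
  sign, with that of the column recurrence at \<open>j - m - 1\<close>; the even coefficients at these two
  places are the same entry of the array.
\<close>
lemma bottom_odd: "e (j - int m - 1) (j - 1) = - p (j - int m) j"
  using diamond[of "j - 1" "j - int m - 1"] f_boundary(3)[of "j - int m - 1"]
    f_boundary(4)[of "j - int m - 1"] f_boundary(3)[of "j - int m"]
    e_boundary(2)[of "j - int m - 1"]
  by (simp add: signed_rule_def)

text \<open>
  Position \<open>j\<close> of row \<open>i\<close> corresponds to position \<open>j - m - 1\<close> of column \<open>i - 2\<close>. The two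
  recurrences differ in one respect: the odd correction is \<open>b * p i (j + 1)\<close> in the row, but
  in the column it is the image of \<open>b * p i j\<close>. The factors \<open>p i (j + 1)\<close> and \<open>p i j\<close>
  differ by \<open>b * f i j\<close>, which is annihilated by the odd element \<open>b\<close>.
\<close>
lemma glide_step:
  assumes range: "-1 \<le> j - i" "j - i \<le> int m"
    and f_prev: "f i (j - 1) = f (j - int m - 2) (i - 2)"
    and f_here: "f i j = f (j - int m - 1) (i - 2)"
    and p_here: "p i j = e (j - int m - 2) (i - 2)"
  shows "f i (j + 1) = f (j - int m) (i - 2)"
    and "p i (j + 1) = e (j - int m - 1) (i - 2)"
proof -
  define b where "b = - p (j - int m) j"
  have range': "-1 \<le> (i - 2) - (j - int m - 1)" "(i - 2) - (j - int m - 1) \<le> int m"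
    using range by auto
  have b': "- e (j - int m - 1) (j - int m - 1 + int m) = - b"
    using bottom_odd[of j] by (simp add: b_def)
  have row: "p i (j + 1) - p i j = b * f i j"
    "f i (j + 1) + f i (j - 1) + b * p i (j + 1) = f (j - int m) (j - 1) * f i j"
    using row_recurrence[OF range] by (simp_all add: b_def)
  have col: "e (j - int m - 2) (i - 2) - e (j - int m - 1) (i - 2) = - b * f i j"
    "f (j - int m - 2) (i - 2) + f (j - int m) (i - 2) + b * p i j = f (j - int m) (j - 1) * f i j"
    using column_recurrence[OF range', unfolded b'] f_here p_here by simp_all
  show "p i (j + 1) = e (j - int m - 1) (i - 2)"
    using row(1) col(1) p_here by (simp add: algebra_simps)
  have "b * b = 0"
    using odd_square[OF p_odd[of j "j - int m"]] by (simp add: b_def)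
  then have "b * (b * f i j) = 0" by (metis mult.assoc mult_zero_left)
  moreover have "p i (j + 1) = p i j + b * f i j" using row(1) by (simp add: algebra_simps)
  ultimately have bp: "b * p i (j + 1) = b * p i j" by (simp add: distrib_left)
  have "f i (j + 1) + f i (j - 1) + b * p i j = f (j - int m) (i - 2) + f i (j - 1) + b * p i j"
    using row(2) unfolding bp col(2)[symmetric] f_prev by (simp add: ac_simps)
  then show "f i (j + 1) = f (j - int m) (i - 2)" by simp
qed

text \<open>
  The recurrence is of second order in \<open>f\<close> and of first order in \<open>p\<close>, so two consecutive
  even entries and one odd entry are carried through the induction. They start on the
  upper boundary for the row and on the lower boundary for the column.
\<close>
lemma glide_along_row:
  assumes "i - 1 \<le> j" "j \<le> i + int m + 1"
  shows "f i (j - 1) = f (j - int m - 2) (i - 2) \<and> f i j = f (j - int m - 1) (i - 2)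
    \<and> p i j = e (j - int m - 2) (i - 2)"
  using assms
proof (induction j rule: int_ge_induct)
  case base
  show ?case
    using f_boundary(1,2)[of i] p_boundary(1)[of i] f_boundary(3)[of "i - int m - 2"]
      f_boundary(4)[of "i - int m - 3"] e_boundary(2)[of "i - int m - 3"]
    by (simp add: algebra_simps)
next
  case (step j)
  then show ?case
    using glide_step[of j i] by (simp add: algebra_simps)
qed

lemma f_glide:
  assumes "-2 \<le> j - i" "j - i \<le> int m + 1"
  shows "f i j = f (j - int m - 1) (i - 2)"
proof (cases "j = i - 2")
  case True
  then show ?thesis using glide_along_row[of i "j + 1"] by simp
next
  case False
  then show ?thesis
    using assms glide_along_row[of i j] by simp
qed

lemma p_glide:
  assumes "-1 \<le> j - i" "j - i \<le> int m + 1"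
  shows "p i j = e (j - int m - 2) (i - 2)"
  using assms glide_along_row[of i j] by simp

text \<open>
  The symmetries of \<open>f\<close> and \<open>p\<close> turn the dual rule for \<open>e i j\<close> into the negative of the frieze
  rule for \<open>p (j - m - 1) (i - 1)\<close>. At \<open>j = i + m + 1\<close> there is no diamond below, but both
  entries lie on the boundary.
\<close>
lemma e_glide:
  assumes "-1 \<le> j - i" "j - i \<le> int m + 1"
  shows "e i j = - p (j - int m - 1) (i - 1)"
proof (cases "j = i + int m + 1")
  case True
  then show ?thesis using e_boundary(2)[of i] p_boundary(1)[of i] by simp
next
  case False
  then have range: "-1 \<le> j - i" "j - i \<le> int m" using assms by auto
  have "e i j = f (i + 1) j * p i (j + 1) - f i j * p (i + 1) (j + 1)"
    using diamond_dual[OF range] by (simp add: signed_rule_def)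
  also have "\<dots> = f (j - int m - 1) (i - 1) * e (j - int m - 1) (i - 2)
      - f (j - int m - 1) (i - 2) * e (j - int m - 1) (i - 1)"
    using range f_glide[of j "i + 1"] f_glide[of j i] p_glide[of "j + 1" i]
      p_glide[of "j + 1" "i + 1"] by (simp add: algebra_simps)
  also have "\<dots> = - p (j - int m - 1) (i - 1)"
    using range diamond[of "i - 2" "j - int m - 1"] by (simp add: signed_rule_def)
  finally show ?thesis .
qed

end

theorem theorem2p6p2:
  fixes R0 R1 :: "'a::{ring, monoid_mult} set"
    and m :: nat
    and f :: "int \<Rightarrow> int \<Rightarrow> 'a"
    and \<phi> :: "rat \<Rightarrow> rat \<Rightarrow> 'a"
  assumes "generic_superfrieze R0 R1 m f \<phi>"
  shows "(\<forall>i j. -2 \<le> j - i \<and> j - i \<le> int m + 1 \<longrightarrow>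
             f i j = f (j - int m - 1) (i - 2))
       \<and> (\<forall>i j :: int. -1 \<le> j - i \<and> j - i \<le> int m + 1 \<longrightarrow>
             \<phi> (of_int i) (of_int j) = \<phi> (of_int j - of_nat m - 3/2) (of_int i - 3/2))
       \<and> (\<forall>i j :: int. -1 \<le> j - i \<and> j - i \<le> int m + 1 \<longrightarrow>
             \<phi> (of_int i + 1/2) (of_int j + 1/2)
               = - \<phi> (of_int j - of_nat m - 1) (of_int i - 1))"
proof -
  interpret generic_superfrieze R0 R1 m f \<phi> by (fact assms)
  have "\<phi> (of_int i) (of_int j) = \<phi> (of_int j - of_nat m - 3/2) (of_int i - 3/2)"
    if "-1 \<le> j - i" "j - i \<le> int m + 1" for i j
    using p_glide[OF that] by (simp add: p_def e_def algebra_simps)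
  moreover have "\<phi> (of_int i + 1/2) (of_int j + 1/2) = - \<phi> (of_int j - of_nat m - 1) (of_int i - 1)"
    if "-1 \<le> j - i" "j - i \<le> int m + 1" for i j
    using e_glide[OF that] by (simp add: p_def e_def)
  ultimately show ?thesis
    using f_glide by blast
qed

end
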